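(* For every integer $n \ge 1$, the prime-generating constant $$h_n = \sum_{k=n}^{\infty} \frac{p_k - 2}{\prod_{i=n}^{k-1} p_i}$$ is irrational.
   Context: $p_k$ denotes the $k$th prime number ($p_1 = 2$, $p_2 = 3$, $p_3 = 5$, and so on). The empty product (the case $k = n$) equals $1$, so that $h_n = (p_n - 2) + \frac{p_{n+1}-2}{p_n} + \frac{p_{n+2}-2}{p_n p_{n+1}} + \cdots$; this series converges for every $n \ge 1$. *)

theory Defs
  imports "HOL-Analysis.Analysis" "HOL-Computational_Algebra.Primes" "HOL-Library.Infinite_Set"
begin

text \<open>
  Primes are indexed from 1, so \<open>nth_prime 1 = 2\<close>, whereas \<open>enumerate\<close> counts from 0.
  The value at index 0 is meaningless (by truncated subtraction it equals \<open>nth_prime 1\<close>).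
\<close>
definition nth_prime :: "nat \<Rightarrow> nat" where
  "nth_prime k = enumerate {p. prime p} (k - 1)"

text \<open>
  The sum over \<open>k \<ge> n\<close> is written with \<open>k = n + j\<close>; the product over \<open>n \<le> i \<le> k - 1\<close>
  is empty for \<open>k = n\<close>. The subtraction of 2 takes place in the reals.
\<close>
definition prime_gen_const :: "nat \<Rightarrow> real" where
  "prime_gen_const n =
     (\<Sum>j. (real (nth_prime (n + j)) - 2) / (\<Prod>i = n..<n + j. real (nth_prime i)))"

lemma nth_prime_strict_mono: "strict_mono_on {1..} nth_prime"
  by (rule strict_mono_onI) (auto simp: nth_prime_def primes_infinite intro!: enumerate_mono)

lemma bij_betw_nth_prime: "bij_betw nth_prime {1..} {p. prime p}"
proof -
  have "bij_betw (\<lambda>k. k - 1) {1..} (UNIV :: nat set)"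
    by (rule bij_betw_byWitness[where f' = Suc]) auto
  moreover have "bij_betw (enumerate {p::nat. prime p}) UNIV {p. prime p}"
    by (rule bij_enumerate) (rule primes_infinite)
  ultimately have "bij_betw (enumerate {p. prime p} \<circ> (\<lambda>k. k - 1)) {1..} {p::nat. prime p}"
    by (rule bij_betw_trans)
  then show ?thesis
    by (simp add: nth_prime_def comp_def cong: bij_betw_cong)
qed

end

theory Submission
  imports Defs "HOL-Real_Asymp.Real_Asymp"
begin

text \<open>
  Write \<open>p\<^sub>k\<close> for the primes and \<open>h\<^sub>m\<close> for the constants. Splitting off the first term of the series
  gives \<open>h\<^sub>m = p\<^sub>m - 2 + T\<^sub>m\<close> with \<open>T\<^sub>m = h\<^sub>m\<^sub>+\<^sub>1 / p\<^sub>m\<close>, hence \<open>p\<^sub>m T\<^sub>m = p\<^sub>m\<^sub>+\<^sub>1 - 2 + T\<^sub>m\<^sub>+\<^sub>1\<close>.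

  If \<open>h\<^sub>n\<close> is rational with denominator \<open>b\<close>, then multiplication by \<open>p\<^sub>m\<close> in the recursion keeps the
  denominator, so \<open>b T\<^sub>m\<close> is an integer for all \<open>m \<ge> n\<close> (\<open>const_tail_multiple_Ints\<close>). Consecutive odd
  primes differ by at least 2, which cancels the \<open>- 2\<close> in the recursion and gives \<open>T\<^sub>m > 1\<close>
  (\<open>const_tail_gt_1\<close>). By integrality \<open>T\<^sub>m \<ge> 1 + 1 / b\<close>. Since \<open>T\<^sub>m\<^sub>+\<^sub>1\<close> is negligible
  against \<open>p\<^sub>m\<^sub>+\<^sub>1\<close> (\<open>const_tail_over_nth_prime_tendsto_0\<close>), the recursion yields
  \<open>p\<^sub>m\<^sub>+\<^sub>1 \<ge> q p\<^sub>m\<close> for all large \<open>m\<close> with a fixed \<open>q > 1\<close>. The primes would then grow geometrically,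
  which is absurd (\<open>nth_prime_not_geometric\<close>).

  The only input about the distribution of primes is \<open>p\<^sub>k\<^sub>+\<^sub>1 / k\<^sup>2 \<rightarrow> 0\<close>
  (\<open>nth_prime_over_square_tendsto_0\<close>). It rules out geometric growth, and as \<open>k < p\<^sub>k\<close> it also gives
  \<open>p\<^sub>k\<^sub>+\<^sub>1 / p\<^sub>k\<^sup>2 \<rightarrow> 0\<close>, from which both the convergence of the series and the estimate of \<open>T\<^sub>m\<close> follow.
  It is a weak form of Chebyshev's bound: a common multiple of \<open>1, \<dots>, 2 r\<close> is divisible
  by \<open>r\<close> times the central binomial coefficient, so it is at least of size \<open>4\<^sup>r / 2\<close>, while there is
  one of size at most \<open>(2 r)\<^sup>c\<close>, where \<open>c\<close> counts the primes up to \<open>2 r\<close>.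
\<close>

section \<open>A Chebyshev-type bound for the primes\<close>

text \<open>
  The recursion of Leibniz's harmonic triangle. Iterated, it expresses the reciprocal of
  \<open>m (n choose m)\<close> as an integer combination of the reciprocals of \<open>1, \<dots>, n\<close>.
\<close>
lemma leibniz_triangle:
  assumes "1 \<le> m" "m < n"
  shows "1 / (real (Suc m) * real (n choose Suc m))
       = 1 / (real m * real ((n - 1) choose m)) - 1 / (real m * real (n choose m))"
proof -
  define A where "A = real ((n - 1) choose m)"
  have "A > 0"
    using assms by (simp add: A_def)
  have "Suc m * (n choose Suc m) = n * ((n - 1) choose m)"
    by (rule binomial_absorption)
  then have succ: "real (Suc m) * real (n choose Suc m) = real n * A"
    unfolding A_def by (metis of_nat_mult)
  have "(n - m) * (n choose m) = n * ((n - 1) choose m)"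
    by (rule binomial_absorb_comp)
  then have "real (n - m) * real (n choose m) = real n * A"
    unfolding A_def by (metis of_nat_mult)
  then have diag: "real (n choose m) = real n * A / (real n - real m)"
    using assms by (simp add: field_simps of_nat_diff)
  show ?thesis
    unfolding succ diag A_def[symmetric] using assms \<open>A > 0\<close> by (simp add: field_simps)
qed

text \<open>
  Induction on \<open>m\<close>, simultaneously for all \<open>n\<close>: the Leibniz triangle reduces the integrality of
  \<open>D / (m (n choose m))\<close> to that of the quotients \<open>D / i\<close> in its first column.
\<close>
lemma mult_binomial_dvd:
  assumes "\<And>i. 1 \<le> i \<Longrightarrow> i \<le> n \<Longrightarrow> i dvd D" "1 \<le> m" "m \<le> n"
  shows "m * (n choose m) dvd D"
proof -
  have "real D / (real m * real (n choose m)) \<in> \<int>"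
    using assms(2,3,1)
  proof (induction m arbitrary: n rule: dec_induct)
    case base
    then obtain c where "D = n * c"
      by (auto simp: dvd_def)
    with base show ?case
      by simp
  next
    case (step m)
    have "real D / (real m * real ((n - 1) choose m)) \<in> \<int>"
      using step.prems by (intro step.IH) auto
    moreover have "real D / (real m * real (n choose m)) \<in> \<int>"
      using step.prems by (intro step.IH) auto
    moreover have "real D / (real (Suc m) * real (n choose Suc m))
        = real D / (real m * real ((n - 1) choose m)) - real D / (real m * real (n choose m))"
      using arg_cong[OF leibniz_triangle[of m n], of "\<lambda>x. real D * x"] step
      by (simp add: right_diff_distrib)
    ultimately show ?case
      by simp
  qed
  then obtain z where "real D / (real m * real (n choose m)) = of_int z"
    by (elim Ints_cases)
  then have "real_of_int (int D) = of_int (z * int (m * (n choose m)))"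
    using assms(2,3) by (simp add: field_simps)
  then have "int D = z * int (m * (n choose m))"
    by (simp only: of_int_eq_iff)
  then have "int (m * (n choose m)) dvd int D"
    by simp
  then show ?thesis
    by (simp only: int_dvd_int_iff)
qed

text \<open>
  The witness is the least common multiple of \<open>1, \<dots>, N\<close>, given by its factorization: each
  prime \<open>p \<le> N\<close> contributes its largest power not exceeding \<open>N\<close>.
\<close>
lemma common_multiple_le_power_prime_count:
  obtains D :: nat where "D > 0" "\<And>i. 1 \<le> i \<Longrightarrow> i \<le> N \<Longrightarrow> i dvd D"
    "D \<le> N ^ card {p. prime p \<and> p \<le> N}"
proof -
  define A where "A = {p. prime p \<and> p \<le> N}"
  define e where "e p = (GREATEST k. p ^ k \<le> N)" for p :: nat
  have "finite A"
    by (rule finite_subset[of _ "{..N}"]) (auto simp: A_def)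
  have bound: "k \<le> N" if "p \<in> A" "p ^ k \<le> N" for p k
  proof -
    have "2 ^ k \<le> p ^ k"
      using that prime_ge_2_nat[of p] by (intro power_mono) (auto simp: A_def)
    with that less_exp[of k] show ?thesis
      by linarith
  qed
  have e_le: "p ^ e p \<le> N" if "p \<in> A" for p
    unfolding e_def
    by (rule GreatestI_nat[where k = 0 and b = N])
       (use that prime_gt_0_nat[of p] in \<open>auto simp: A_def intro: bound[OF that]\<close>)
  have le_e: "k \<le> e p" if "p \<in> A" "p ^ k \<le> N" for p k
    unfolding e_def
    by (rule Greatest_le_nat[where b = N]) (use that bound in auto)
  define D where "D = (\<Prod>p\<in>A. p ^ e p)"
  have "i dvd D" if i: "1 \<le> i" "i \<le> N" for i
  proof -
    have "(\<Prod>p\<in>prime_factors i. p ^ multiplicity p i) dvd D"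
      unfolding D_def
    proof (rule prod_dvd_prod_subset2)
      show "prime_factors i \<subseteq> A"
        using i by (auto simp: A_def prime_factors_dvd dest: dvd_imp_le)
      fix p assume p: "p \<in> prime_factors i"
      have "p ^ multiplicity p i \<le> N"
        using i by (meson dvd_imp_le less_le_trans le_trans multiplicity_dvd zero_less_one)
      with p \<open>prime_factors i \<subseteq> A\<close> show "p ^ multiplicity p i dvd p ^ e p"
        by (intro le_imp_power_dvd le_e) auto
    qed fact
    then show ?thesis
      using i prod_prime_factors[of i] by simp
  qed
  moreover have "D \<le> (\<Prod>p\<in>A. N)"
    unfolding D_def by (intro prod_mono) (use e_le in auto)
  then have "D \<le> N ^ card A"
    by simp
  moreover have "D > 0"
    unfolding D_def by (intro prod_pos) (auto simp: A_def prime_gt_0_nat)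
  ultimately show thesis
    using that unfolding A_def by blast
qed

lemma prime_nth_prime: "k \<ge> 1 \<Longrightarrow> prime (nth_prime k)"
  using bij_betw_apply[OF bij_betw_nth_prime] by auto

lemma nth_prime_less: "1 \<le> i \<Longrightarrow> i < j \<Longrightarrow> nth_prime i < nth_prime j"
  using nth_prime_strict_mono by (auto simp: strict_mono_on_def)

lemma index_less_nth_prime: "k \<ge> 1 \<Longrightarrow> k < nth_prime k"
proof (induction k rule: dec_induct)
  case base
  show ?case
    using prime_gt_1_nat[OF prime_nth_prime[of 1]] by simp
next
  case (step k)
  then show ?case
    using nth_prime_less[of k "Suc k"] by simp
qed

lemma card_primes_less_nth_prime: "card {p. prime p \<and> p < nth_prime (Suc k)} \<le> k"
proof -
  have "{p. prime p \<and> p < nth_prime (Suc k)} \<subseteq> nth_prime ` {1..k}"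
  proof safe
    fix p :: nat
    assume p: "prime p" "p < nth_prime (Suc k)"
    then obtain i where i: "i \<ge> 1" "p = nth_prime i"
      using bij_betw_imp_surj_on[OF bij_betw_nth_prime] by auto
    have "i \<le> k"
    proof (rule ccontr)
      assume "\<not> i \<le> k"
      then have "nth_prime (Suc k) \<le> nth_prime i"
        using nth_prime_less[of "Suc k" i] by (cases "i = Suc k") auto
      with p i show False
        by simp
    qed
    with i show "p \<in> nth_prime ` {1..k}"
      by auto
  qed
  then have "card {p. prime p \<and> p < nth_prime (Suc k)} \<le> card (nth_prime ` {1..k})"
    by (intro card_mono) auto
  also have "\<dots> \<le> k"
    using card_image_le[of "{1..k}" nth_prime] by simp
  finally show ?thesis .
qed

lemma odd_nth_prime:
  assumes "k \<ge> 2"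
  shows "odd (nth_prime k)"
  using assms prime_nth_prime[of k] index_less_nth_prime[of k] prime_odd_nat[of "nth_prime k"]
  by simp

lemma nth_prime_gap:
  assumes "k \<ge> 2"
  shows "nth_prime k + 2 \<le> nth_prime (Suc k)"
  using assms odd_nth_prime[of k] odd_nth_prime[of "Suc k"] nth_prime_less[of k "Suc k"]
  by (cases "nth_prime (Suc k) = Suc (nth_prime k)") auto

text \<open>
  The number just below an odd prime is an even number \<open>N = 2 r\<close> with exactly \<open>k\<close> primes up to it.
  Comparing the lower bound \<open>r (2 r choose r)\<close> and the upper bound \<open>N\<^sup>k\<close> for a common multiple of
  \<open>1, \<dots>, N\<close> gives the claim.
\<close>
lemma nth_prime_exponential_bound:
  assumes "k \<ge> 1"
  shows "2 ^ (nth_prime (Suc k) - 2) \<le> (nth_prime (Suc k) - 1) ^ k"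
proof -
  define N where "N = nth_prime (Suc k) - 1"
  have gt: "nth_prime (Suc k) > 2"
    using index_less_nth_prime[of "Suc k"] assms by simp
  then obtain r where r: "N = 2 * r" "r \<ge> 1"
    using odd_nth_prime[of "Suc k"] assms unfolding N_def by (auto elim!: oddE)
  obtain D where D: "D > 0" "\<And>i. 1 \<le> i \<Longrightarrow> i \<le> N \<Longrightarrow> i dvd D"
      "D \<le> N ^ card {p. prime p \<and> p \<le> N}"
    using common_multiple_le_power_prime_count by blast
  have "{p. prime p \<and> p \<le> N} = {p. prime p \<and> p < nth_prime (Suc k)}"
    using gt unfolding N_def by auto
  then have card: "card {p. prime p \<and> p \<le> N} \<le> k"
    using card_primes_less_nth_prime[of k] by simp
  have "(2::real) ^ (N - 1) = real r * (4 ^ r / (2 * real r))"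
    proof -
    have "N - 1 = Suc (2 * (r - 1))" "2 * r = Suc (Suc (2 * (r - 1)))"
      using r by auto
    then have "(2::real) ^ (2 * r) = 2 * 2 ^ (N - 1)"
      by simp
    then show ?thesis
      using r by (simp add: power_mult)
  qed
  also have "\<dots> \<le> real r * real ((2 * r) choose r)"
    using r by (intro mult_left_mono central_binomial_lower_bound) auto
  also have "\<dots> = real (r * (N choose r))"
    by (simp add: r)
  also have "\<dots> \<le> real D"
    using mult_binomial_dvd[of N D r] D(1,2) r by (simp only: of_nat_le_iff) (auto intro!: dvd_imp_le)
  also have "\<dots> \<le> real (N ^ card {p. prime p \<and> p \<le> N})"
    using D by (simp only: of_nat_le_iff)
  also have "\<dots> \<le> real (N ^ k)"
    using card r by (simp only: of_nat_le_iff) (intro power_increasing, auto)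
  finally have "real (2 ^ (N - 1)) \<le> real (N ^ k)"
    by simp
  then have "2 ^ (N - 1) \<le> N ^ k"
    by (simp only: of_nat_le_iff)
  then show ?thesis
    by (simp add: N_def numeral_2_eq_2)
qed

text \<open>
  Taking logarithms in the exponential bound shows \<open>k \<ge> (P - 2) ln 2 / ln P\<close> for
  \<open>P = p\<^sub>k\<^sub>+\<^sub>1\<close>, so \<open>P / k\<^sup>2\<close> is at most a function of \<open>P\<close> of order \<open>(ln P)\<^sup>2 / P\<close>.
\<close>
lemma nth_prime_over_square_tendsto_0:
  "(\<lambda>k. real (nth_prime (Suc k)) / real k ^ 2) \<longlonglongrightarrow> 0"
proof (rule tendsto_sandwich[OF _ _ tendsto_const])
  have "((\<lambda>x::real. x / ((x - 2) * ln 2 / ln x) ^ 2) \<longlongrightarrow> 0) at_top"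
    by real_asymp
  moreover have "filterlim (\<lambda>k. real (nth_prime (Suc k))) at_top sequentially"
  proof (rule filterlim_at_top_mono[OF filterlim_real_sequentially])
    show "\<forall>\<^sub>F k in sequentially. real k \<le> real (nth_prime (Suc k))"
    proof (intro always_eventually allI)
      show "real k \<le> real (nth_prime (Suc k))" for k
        using index_less_nth_prime[of "Suc k"] by simp
    qed
  qed
  ultimately show "(\<lambda>k. real (nth_prime (Suc k)) /
      ((real (nth_prime (Suc k)) - 2) * ln 2 / ln (real (nth_prime (Suc k)))) ^ 2) \<longlonglongrightarrow> 0"
    by (rule filterlim_compose)
  show "\<forall>\<^sub>F k in sequentially. real (nth_prime (Suc k)) / real k ^ 2 \<le>
      real (nth_prime (Suc k)) /
      ((real (nth_prime (Suc k)) - 2) * ln 2 / ln (real (nth_prime (Suc k)))) ^ 2"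
    using eventually_ge_at_top[of 1]
  proof eventually_elim
    case (elim k)
    define P where "P = nth_prime (Suc k)"
    have P: "P > 2"
      using index_less_nth_prime[of "Suc k"] elim by (simp add: P_def)
    have "real (2 ^ (P - 2)) \<le> real ((P - 1) ^ k)"
      using nth_prime_exponential_bound[OF elim] unfolding P_def by (simp only: of_nat_le_iff)
    also have "\<dots> \<le> real (P ^ k)"
      by (simp only: of_nat_le_iff) (intro power_mono, auto)
    finally have "ln ((2::real) ^ (P - 2)) \<le> ln (real P ^ k)"
      using P by (intro ln_mono) auto
    then have "(real P - 2) * ln 2 \<le> real k * ln (real P)"
      using P by (simp add: ln_realpow of_nat_diff)
    then have "(real P - 2) * ln 2 / ln (real P) \<le> real k"
      using P by (simp add: divide_le_eq)
    moreover have "(real P - 2) * ln 2 / ln (real P) > 0"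
      using P by simp
    ultimately show ?case
      unfolding P_def[symmetric] by (intro divide_left_mono power_mono) (auto intro!: mult_pos_pos zero_less_power simp: elim)
  qed
qed auto

section \<open>Convergence and size of the series\<close>

lemma nth_prime_over_prev_square_tendsto_0:
  "(\<lambda>k. real (nth_prime (Suc k)) / real (nth_prime k) ^ 2) \<longlonglongrightarrow> 0"
proof (rule tendsto_sandwich[OF _ _ tendsto_const nth_prime_over_square_tendsto_0])
  show "\<forall>\<^sub>F k in sequentially. real (nth_prime (Suc k)) / real (nth_prime k) ^ 2
      \<le> real (nth_prime (Suc k)) / real k ^ 2"
    using eventually_ge_at_top[of 1]
  proof eventually_elim
    case (elim k)
    then show ?case
      using index_less_nth_prime[of k] by (intro divide_left_mono power_mono) auto
  qed
qed auto

definition const_term :: "nat \<Rightarrow> nat \<Rightarrow> real" where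
  "const_term n j = (real (nth_prime (n + j)) - 2) / (\<Prod>i = n..<n + j. real (nth_prime i))"

text \<open>
  Without the \<open>- 2\<close> in the numerators, the quotient of successive terms is simply
  \<open>p\<^sub>k\<^sub>+\<^sub>1 / p\<^sub>k\<^sup>2\<close>.
\<close>
definition majorant :: "nat \<Rightarrow> nat \<Rightarrow> real" where
  "majorant n j = real (nth_prime (n + j)) / (\<Prod>i = n..<n + j. real (nth_prime i))"

lemma nth_prime_ge_2: "k \<ge> 1 \<Longrightarrow> real (nth_prime k) \<ge> 2"
  using prime_ge_2_nat[OF prime_nth_prime] by simp

lemma prod_nth_prime_pos: "n \<ge> 1 \<Longrightarrow> (\<Prod>i = n..<m. real (nth_prime i)) > 0"
  by (intro prod_pos) (simp add: prime_gt_0_nat prime_nth_prime)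

lemma const_term_bounds:
  assumes "n \<ge> 1"
  shows "0 \<le> const_term n j" "const_term n j \<le> majorant n j"
  using nth_prime_ge_2[of "n + j"] prod_nth_prime_pos[of n "n + j"] assms
  by (auto simp: const_term_def majorant_def intro!: divide_right_mono)

lemma majorant_Suc:
  assumes "n \<ge> 1"
  shows "majorant n (Suc j) =
    real (nth_prime (Suc (n + j))) / real (nth_prime (n + j)) ^ 2 * majorant n j"
  using nth_prime_ge_2[of "n + j"] assms
  by (simp add: majorant_def power2_eq_square)

text \<open>
  The ratio of consecutive terms of the majorant is \<open>p\<^sub>k\<^sub>+\<^sub>1 / p\<^sub>k\<^sup>2\<close> with \<open>k = n + j\<close>. It depends only on
  \<open>k\<close>, so a single threshold works for all \<open>n\<close>. For fixed \<open>n\<close> this is the ratio test; for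
  \<open>n\<close> beyond the threshold it bounds the whole series by a geometric one.
\<close>
lemma majorant_halves_eventually:
  obtains K where "\<And>n j. n \<ge> 1 \<Longrightarrow> n + j \<ge> K \<Longrightarrow> majorant n (Suc j) \<le> 1 / 2 * majorant n j"
proof -
  have "\<forall>\<^sub>F k in sequentially. real (nth_prime (Suc k)) / real (nth_prime k) ^ 2 < 1 / 2"
    using nth_prime_over_prev_square_tendsto_0 by (rule order_tendstoD) simp
  then obtain K where K: "\<And>k. k \<ge> K \<Longrightarrow>
      real (nth_prime (Suc k)) / real (nth_prime k) ^ 2 < 1 / 2"
    by (auto simp: eventually_at_top_linorder)
  show thesis
  proof (rule that)
    fix n j :: nat
    assume nj: "n \<ge> 1" "n + j \<ge> K"
    have "majorant n j \<ge> 0"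
      using const_term_bounds[OF nj(1), of j] by linarith
    then show "majorant n (Suc j) \<le> 1 / 2 * majorant n j"
      unfolding majorant_Suc[OF nj(1)] using K[OF nj(2)] by (intro mult_right_mono) auto
  qed
qed

lemma prime_gen_const_summable:
  assumes "n \<ge> 1"
  shows "summable (const_term n)"
proof (rule summable_comparison_test'[where N = 0])
  obtain K where K: "\<And>n j. n \<ge> 1 \<Longrightarrow> n + j \<ge> K \<Longrightarrow> majorant n (Suc j) \<le> 1 / 2 * majorant n j"
    using majorant_halves_eventually by blast
  show "summable (majorant n)"
  proof (rule summable_ratio_test[where c = "1 / 2" and N = K])
    fix j assume "j \<ge> K"
    moreover have "0 \<le> majorant n i" for i
      using const_term_bounds[OF assms, of i] by linarith
    ultimately show "norm (majorant n (Suc j)) \<le> 1 / 2 * norm (majorant n j)"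
      using K[OF assms, of j] by simp
  qed simp
qed (use const_term_bounds[OF assms] in simp)

lemma prime_gen_const_eq: "prime_gen_const n = (\<Sum>j. const_term n j)"
  by (simp add: prime_gen_const_def const_term_def)

lemma const_term_Suc:
  "const_term n (Suc j) = const_term (Suc n) j / real (nth_prime n)"
proof -
  have "(\<Prod>i = n..<n + Suc j. real (nth_prime i))
      = real (nth_prime n) * (\<Prod>i = Suc n..<Suc n + j. real (nth_prime i))"
    by (subst prod.atLeast_Suc_lessThan) auto
  then show ?thesis
    by (simp add: const_term_def)
qed

lemma prime_gen_const_rec:
  assumes "n \<ge> 1"
  shows "prime_gen_const n = real (nth_prime n) - 2 + prime_gen_const (Suc n) / real (nth_prime n)"
proof -
  have "(\<Sum>j. const_term n (Suc j)) = prime_gen_const (Suc n) / real (nth_prime n)"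
    unfolding const_term_Suc prime_gen_const_eq
    by (intro suminf_divide prime_gen_const_summable) simp
  then show ?thesis
    using suminf_split_head[OF prime_gen_const_summable[OF assms]]
    unfolding prime_gen_const_eq[of n] by (simp add: const_term_def[of n 0])
qed

lemma prime_gen_const_nonneg: "n \<ge> 1 \<Longrightarrow> prime_gen_const n \<ge> 0"
  unfolding prime_gen_const_eq
  by (intro suminf_nonneg prime_gen_const_summable const_term_bounds)

lemma prime_gen_const_pos:
  assumes "n \<ge> 2"
  shows "prime_gen_const n > 0"
proof -
  have "real (nth_prime n) > 2"
    using index_less_nth_prime[of n] assms by simp
  moreover have "prime_gen_const (Suc n) / real (nth_prime n) \<ge> 0"
    by (intro divide_nonneg_nonneg prime_gen_const_nonneg) auto
  ultimately show ?thesis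
    using prime_gen_const_rec[of n] assms by linarith
qed

text \<open>
  The first term of the majorant is \<open>p\<^sub>n\<close>, and for large \<open>n\<close> every later term is at most half of
  the one before, so the sum is at most twice the first term.
\<close>
lemma eventually_prime_gen_const_le:
  "\<forall>\<^sub>F n in sequentially. prime_gen_const n \<le> 2 * real (nth_prime n)"
proof -
  obtain K where K: "\<And>n j. n \<ge> 1 \<Longrightarrow> n + j \<ge> K \<Longrightarrow> majorant n (Suc j) \<le> 1 / 2 * majorant n j"
    using majorant_halves_eventually by blast
  show ?thesis
    using eventually_ge_at_top[of K] eventually_ge_at_top[of 1]
  proof eventually_elim
    case (elim n)
    have maj: "majorant n j \<le> real (nth_prime n) * (1 / 2) ^ j" for j
    proof (induction j)
      case (Suc j)
      have "majorant n (Suc j) \<le> 1 / 2 * majorant n j"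
        using K[of n j] elim by simp
      with Suc show ?case
        by simp
    qed (simp add: majorant_def)
    have geo: "(\<lambda>j. real (nth_prime n) * (1 / 2) ^ j) sums (real (nth_prime n) * (1 / (1 - 1 / 2)))"
      by (intro sums_mult geometric_sums) simp
    have "prime_gen_const n \<le> (\<Sum>j. real (nth_prime n) * (1 / 2) ^ j)"
      unfolding prime_gen_const_eq
      using order_trans[OF const_term_bounds(2)[OF elim(2)] maj]
      by (intro suminf_le prime_gen_const_summable[OF elim(2)] sums_summable[OF geo]) auto
    also have "\<dots> = 2 * real (nth_prime n)"
      using sums_unique[OF geo] by simp
    finally show ?case .
  qed
qed

section \<open>Irrationality\<close>

definition const_tail :: "nat \<Rightarrow> real" where
  "const_tail n = prime_gen_const (Suc n) / real (nth_prime n)"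

lemma const_tail_rec:
  assumes "n \<ge> 1"
  shows "real (nth_prime n) * const_tail n = real (nth_prime (Suc n)) - 2 + const_tail (Suc n)"
  using prime_gen_const_rec[of "Suc n"] nth_prime_ge_2[of n] assms
  by (simp add: const_tail_def)

text \<open>
  In \<open>p\<^sub>n T\<^sub>n = p\<^sub>n\<^sub>+\<^sub>1 - 2 + T\<^sub>n\<^sub>+\<^sub>1\<close> the right-hand side exceeds \<open>p\<^sub>n\<close> because the prime gap
  compensates the 2 and \<open>T\<^sub>n\<^sub>+\<^sub>1\<close> is positive. The gap between 2 and 3 is too small for this, hence \<open>n \<ge> 2\<close>.
\<close>
lemma const_tail_gt_1:
  assumes "n \<ge> 2"
  shows "const_tail n > 1"
proof -
  have "const_tail (Suc n) > 0"
    unfolding const_tail_def using prime_gen_const_pos[of "Suc (Suc n)"] nth_prime_ge_2[of "Suc n"]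
    by (intro divide_pos_pos) auto
  moreover have "real (nth_prime (Suc n)) \<ge> real (nth_prime n) + 2"
    using nth_prime_gap[OF assms] by linarith
  ultimately have "real (nth_prime n) * const_tail n > real (nth_prime n) * 1"
    using const_tail_rec[of n] assms by linarith
  then show ?thesis
    by (rule mult_left_less_imp_less) simp
qed

text \<open>
  The estimate \<open>h\<^sub>n\<^sub>+\<^sub>1 \<le> 2 p\<^sub>n\<^sub>+\<^sub>1\<close> bounds this quotient by \<open>2 p\<^sub>n\<^sub>+\<^sub>1 / p\<^sub>n\<^sup>2\<close>.
\<close>
lemma const_tail_over_nth_prime_tendsto_0:
  "(\<lambda>n. const_tail n / real (nth_prime n)) \<longlonglongrightarrow> 0"
proof (rule tendsto_sandwich[OF _ _ tendsto_const])
  show "(\<lambda>n. 2 * (real (nth_prime (Suc n)) / real (nth_prime n) ^ 2)) \<longlonglongrightarrow> 0"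
    using tendsto_mult[OF tendsto_const nth_prime_over_prev_square_tendsto_0, of 2] by simp
  show "\<forall>\<^sub>F n in sequentially. 0 \<le> const_tail n / real (nth_prime n)"
    by (intro always_eventually allI) (simp add: const_tail_def prime_gen_const_nonneg)
  have "\<forall>\<^sub>F n in sequentially. prime_gen_const (Suc n) \<le> 2 * real (nth_prime (Suc n))"
    using eventually_prime_gen_const_le by (subst eventually_sequentially_Suc)
  then show "\<forall>\<^sub>F n in sequentially. const_tail n / real (nth_prime n)
      \<le> 2 * (real (nth_prime (Suc n)) / real (nth_prime n) ^ 2)"
  proof eventually_elim
    case (elim n)
    then show ?case
      by (simp add: const_tail_def power2_eq_square divide_right_mono)
  qed
qed

lemma nth_prime_not_geometric:
  assumes "q > 1"
  shows "\<not> (\<forall>\<^sub>F n in sequentially. q * real (nth_prime n) \<le> real (nth_prime (Suc n)))"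
proof
  assume "\<forall>\<^sub>F n in sequentially. q * real (nth_prime n) \<le> real (nth_prime (Suc n))"
  then obtain K0 where K0: "\<And>n. n \<ge> K0 \<Longrightarrow> q * real (nth_prime n) \<le> real (nth_prime (Suc n))"
    by (auto simp: eventually_at_top_linorder)
  define K where "K = max K0 1"
  have geometric: "q ^ j \<le> real (nth_prime (K + j))" for j
  proof (induction j)
    case 0
    show ?case
      using nth_prime_ge_2[of K] by (simp add: K_def)
  next
    case (Suc j)
    then have "q ^ Suc j \<le> q * real (nth_prime (K + j))"
      using assms by simp
    also have "\<dots> \<le> real (nth_prime (K + Suc j))"
      using K0[of "K + j"] by (simp add: K_def)
    finally show ?case .
  qed
  have "(\<lambda>j. real (nth_prime (Suc (j + K))) / real (j + K) ^ 2) \<longlonglongrightarrow> 0"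
    using LIMSEQ_ignore_initial_segment[OF nth_prime_over_square_tendsto_0] .
  then have "\<forall>\<^sub>F j in sequentially. real (nth_prime (Suc (j + K))) / real (j + K) ^ 2 < 1"
    by (rule order_tendstoD) simp
  moreover have "\<forall>\<^sub>F j in sequentially. q ^ Suc j / real (j + K) ^ 2 > 1"
    using assms by real_asymp
  ultimately have "\<forall>\<^sub>F j::nat in sequentially. False"
  proof eventually_elim
    case (elim j)
    have "q ^ Suc j / real (j + K) ^ 2 \<le> real (nth_prime (Suc (j + K))) / real (j + K) ^ 2"
      using geometric[of "Suc j"] by (intro divide_right_mono) (auto simp: add.commute)
    with elim show False
      by linarith
  qed
  then show False
    by simp
qed

text \<open>
  A denominator \<open>b\<close> of \<open>h\<^sub>n\<close> persists: \<open>b T\<^sub>m = b h\<^sub>m - b (p\<^sub>m - 2)\<close> and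
  \<open>b h\<^sub>m\<^sub>+\<^sub>1 = p\<^sub>m (b T\<^sub>m)\<close> carry integrality alternately from \<open>h\<close> to \<open>T\<close> and back.
\<close>
lemma const_tail_multiple_Ints:
  assumes "n \<ge> 1" "real b * prime_gen_const n \<in> \<int>" "n \<le> m"
  shows "real b * const_tail m \<in> \<int>"
proof -
  have tail: "real b * const_tail m \<in> \<int>" if "real b * prime_gen_const m \<in> \<int>" "m \<ge> 1" for m
  proof -
    have "real b * const_tail m
        = real b * prime_gen_const m - of_int (int b * (int (nth_prime m) - 2))"
      unfolding prime_gen_const_rec[OF that(2)] by (simp add: const_tail_def algebra_simps)
    also have "\<dots> \<in> \<int>"
      by (intro Ints_diff that(1) Ints_of_int)
    finally show ?thesis .
  qed
  have "real b * prime_gen_const m \<in> \<int>"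
    using assms(3)
  proof (induction m rule: dec_induct)
    case (step m)
    then have "m \<ge> 1"
      using assms(1) by simp
    then have "real b * prime_gen_const (Suc m) = real (nth_prime m) * (real b * const_tail m)"
      using nth_prime_ge_2[of m] by (simp add: const_tail_def)
    also have "\<dots> \<in> \<int>"
      using tail[OF step.IH \<open>m \<ge> 1\<close>] by (rule Ints_mult[OF Ints_of_nat])
    finally show ?case .
  qed fact
  then show ?thesis
    using tail assms by simp
qed

theorem theorem2:
  fixes n :: nat
  assumes "n \<ge> 1"
  shows "prime_gen_const n \<notin> \<rat>"
proof
  assume "prime_gen_const n \<in> \<rat>"
  then obtain a :: int and b :: nat where b: "b > 0" and ab: "prime_gen_const n = of_int a / real b"
    unfolding Rats_eq_int_div_nat neq0_conv by blast
  then have "real b * prime_gen_const n \<in> \<int>"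
    by simp
  note Ints = const_tail_multiple_Ints[OF assms this]
  have lower: "const_tail m \<ge> 1 + 1 / real b" if "m \<ge> n" "m \<ge> 2" for m
  proof -
    obtain z where z: "real b * const_tail m = of_int z"
      using Ints[OF \<open>m \<ge> n\<close>] by (elim Ints_cases)
    have "real b * 1 < real b * const_tail m"
      using const_tail_gt_1[OF \<open>m \<ge> 2\<close>] b by (intro mult_strict_left_mono) auto
    then have "z \<ge> int b + 1"
      using z by linarith
    then have "real b + 1 \<le> real b * const_tail m"
      using z by linarith
    then show ?thesis
      using b by (simp add: field_simps)
  qed
  \<comment> \<open>Half of the excess \<open>1 / b\<close> is given away to absorb \<open>T\<^sub>m\<^sub>+\<^sub>1 \<le> p\<^sub>m\<^sub>+\<^sub>1 / (2 b)\<close>; the quotient of the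
    two factors is still larger than 1.\<close>
  define q where "q = (1 + 1 / real b) / (1 + 1 / (2 * real b))"
  have "q > 1"
    proof -
    have "1 + 1 / (2 * real b) < 1 + 1 / real b"
      using b by (simp add: field_simps)
    moreover have "0 < 1 + 1 / (2 * real b)"
      by (simp add: add_pos_nonneg)
    ultimately show ?thesis
      unfolding q_def by (subst less_divide_eq_1_pos) auto
  qed
  have "(\<lambda>m. const_tail (Suc m) / real (nth_prime (Suc m))) \<longlonglongrightarrow> 0"
    using const_tail_over_nth_prime_tendsto_0 by (rule LIMSEQ_Suc)
  then have "\<forall>\<^sub>F m in sequentially.
      const_tail (Suc m) / real (nth_prime (Suc m)) < 1 / (2 * real b)"
    by (rule order_tendstoD) (use b in simp)
  then have "\<forall>\<^sub>F m in sequentially. q * real (nth_prime m) \<le> real (nth_prime (Suc m))"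
    using eventually_ge_at_top[of n] eventually_ge_at_top[of 2]
  proof eventually_elim
    case (elim m)
    have small: "const_tail (Suc m) \<le> 1 / (2 * real b) * real (nth_prime (Suc m))"
      using elim(1) nth_prime_ge_2[of "Suc m"] by (simp only: divide_less_eq) auto
    have "(1 + 1 / real b) * real (nth_prime m) \<le> const_tail m * real (nth_prime m)"
      using lower[of m] elim by (intro mult_right_mono) auto
    also have "\<dots> \<le> real (nth_prime (Suc m)) + const_tail (Suc m)"
      using const_tail_rec[of m] elim by (simp add: mult.commute)
    also have "\<dots> \<le> (1 + 1 / (2 * real b)) * real (nth_prime (Suc m))"
      using small by (simp add: distrib_right)
    finally have "(1 + 1 / real b) * real (nth_prime m) / (1 + 1 / (2 * real b))
        \<le> real (nth_prime (Suc m))"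
      using b by (subst pos_divide_le_eq) (auto simp: mult.commute add_pos_nonneg)
    then show ?case
      by (simp add: q_def)
  qed
  with nth_prime_not_geometric[OF \<open>q > 1\<close>] show False
    by blast
qed

end
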